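(* Consider unconstrained convex function chasing in $\mathbb{R}^d$ with starting point $x_0$, where every request $f_t$ is $\kappa$-well-conditioned and satisfies $\min_{x\in\mathbb{R}^d}f_t(x)=0$. Let $(x_1,\dots,x_T)$ be the points played by the Move Towards Minimizer algorithm, let $(y_1,\dots,y_T)$ be an optimal offline sequence (with $y_0=x_0$), and let $\Phi_t:=\|x_t-y_t\|_2$. With $c:=4+4\sqrt2$, for each $t$, $$\|x_t-x_{t-1}\|_2+f_t(x_t)+2\sqrt2\,(\Phi_t-\Phi_{t-1})\le c\,\kappa\,\big(\|y_t-y_{t-1}\|_2+f_t(y_t)\big).$$ Hence the Move Towards Minimizer algorithm is $c\kappa$-competitive.
   Context: Convex function chasing: a starting point $x_0\in\mathbb{R}^d$ is fixed; non-negative convex differentiable $f_1,\dots,f_T:\mathbb{R}^d\to[0,\infty)$ arrive online; after seeing $f_t$ the algorithm chooses $x_t\in\mathbb{R}^d$; total cost is $\sum_t(\|x_t-x_{t-1}\|_2+f_t(x_t))$, and $OPT$ is the minimum of this over offline sequences with $y_0=x_0$; $c$-competitive means cost at most $c\cdot OPT$ on every instance. $f$ is $\kappa$-well-conditioned if for some $\alpha>0$ (depending on $f$) it is $\alpha$-strongly convex ($f(y)-f(x)-\langle\nabla f(x),y-x\rangle\ge\frac\alpha2\|x-y\|_2^2$ for all $x,y$) and $\alpha\kappa$-smooth ($f(y)-f(x)-\langle\nabla f(x),y-x\rangle\le\frac{\alpha\kappa}2\|x-y\|_2^2$ for all $x,y$). Move Towards Minimizer (M2M): on receiving $f_t$ while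 at $x_{t-1}$, let $x_t^*=\arg\min_x f_t(x)$ and let $x_t$ be the unique point on the segment between $x_{t-1}$ and $x_t^*$ with $\|x_t-x_{t-1}\|_2=f_t(x_t)-f_t(x_t^* )$; play $x_t$. *)

theory Defs
  imports "HOL-Analysis.Analysis"
begin

definition gradient :: "('a::euclidean_space \<Rightarrow> real) \<Rightarrow> 'a \<Rightarrow> 'a" where
  "gradient f x = (THE D. GDERIV f x :> D)"

lemma GDERIV_gradient:
  fixes f :: "'a::euclidean_space \<Rightarrow> real"
  assumes "f differentiable (at x)"
  shows "GDERIV f x :> gradient f x"
proof -
  from assms obtain f' where f': "(f has_derivative f') (at x)"
    by (auto simp: differentiable_def)
  define D where "D = (\<Sum>b\<in>Basis. f' b *\<^sub>R b)"
  have lin: "linear f'"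
    using f' has_derivative_linear by blast
  have "f' = (\<lambda>h. inner h D)"
  proof
    fix h
    have "f' h = f' (\<Sum>b\<in>Basis. (h \<bullet> b) *\<^sub>R b)"
      by (simp add: euclidean_representation)
    also have "\<dots> = (\<Sum>b\<in>Basis. (h \<bullet> b) *\<^sub>R f' b)"
      using lin by (simp add: linear_sum linear_scale)
    also have "\<dots> = inner h D"
      by (simp add: D_def inner_sum_right mult.commute)
    finally show "f' h = inner h D" .
  qed
  then have "GDERIV f x :> D"
    using f' by (simp add: gderiv_def)
  moreover have "E = D" if "GDERIV f x :> E" for E
  proof -
    have "(\<lambda>h. inner h E) = (\<lambda>h. inner h D)"
      using that \<open>GDERIV f x :> D\<close> has_derivative_unique unfolding gderiv_def by blast
    then show ?thesis
      by (metis vector_eq_rdot inner_commute)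
  qed
  ultimately show ?thesis
    unfolding gradient_def by (rule theI)
qed

definition strongly_convex :: "real \<Rightarrow> ('a::euclidean_space \<Rightarrow> real) \<Rightarrow> bool" where
  "strongly_convex \<alpha> f \<longleftrightarrow>
     (\<forall>x y. f y - f x - gradient f x \<bullet> (y - x) \<ge> \<alpha> / 2 * (norm (x - y))\<^sup>2)"

definition smooth :: "real \<Rightarrow> ('a::euclidean_space \<Rightarrow> real) \<Rightarrow> bool" where
  "smooth \<beta> f \<longleftrightarrow>
     (\<forall>x y. f y - f x - gradient f x \<bullet> (y - x) \<le> \<beta> / 2 * (norm (x - y))\<^sup>2)"

definition well_conditioned :: "real \<Rightarrow> ('a::euclidean_space \<Rightarrow> real) \<Rightarrow> bool" where
  "well_conditioned \<kappa> f \<longleftrightarrow> (\<exists>\<alpha>>0. strongly_convex \<alpha> f \<and> smooth (\<alpha> * \<kappa>) f)"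

definition request :: "('a::euclidean_space \<Rightarrow> real) \<Rightarrow> bool" where
  "request f \<longleftrightarrow> (\<forall>x. 0 \<le> f x) \<and> convex_on UNIV f \<and> (\<forall>x. f differentiable (at x))"

definition min_value :: "('a \<Rightarrow> real) \<Rightarrow> real \<Rightarrow> bool" where
  "min_value f m \<longleftrightarrow> (\<exists>z. is_arg_min f (\<lambda>_. True) z \<and> f z = m)"

definition well_conditioned_request :: "real \<Rightarrow> ('a::euclidean_space \<Rightarrow> real) \<Rightarrow> bool" where
  "well_conditioned_request \<kappa> f \<longleftrightarrow> request f \<and> well_conditioned \<kappa> f \<and> min_value f 0"

text \<open>
  An instance is a starting point \<open>x\<^sub>0\<close>, a horizon \<open>T\<close> and requests \<open>f 1, \<dots>, f T\<close>.
  Point sequences \<open>x\<close> are indexed by \<open>0, \<dots>, T\<close>; values beyond \<open>T\<close> are irrelevant.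
\<close>

definition step_cost :: "(nat \<Rightarrow> 'a::euclidean_space \<Rightarrow> real) \<Rightarrow> (nat \<Rightarrow> 'a) \<Rightarrow> nat \<Rightarrow> real" where
  "step_cost f x t = norm (x t - x (t - 1)) + f t (x t)"

definition total_cost :: "nat \<Rightarrow> (nat \<Rightarrow> 'a::euclidean_space \<Rightarrow> real) \<Rightarrow> (nat \<Rightarrow> 'a) \<Rightarrow> real" where
  "total_cost T f x = (\<Sum>t=1..T. step_cost f x t)"

definition offline_optimal ::
    "'a::euclidean_space \<Rightarrow> nat \<Rightarrow> (nat \<Rightarrow> 'a \<Rightarrow> real) \<Rightarrow> (nat \<Rightarrow> 'a) \<Rightarrow> bool" where
  "offline_optimal x\<^sub>0 T f y \<longleftrightarrow> is_arg_min (total_cost T f) (\<lambda>z. z 0 = x\<^sub>0) y"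

definition OPT :: "'a::euclidean_space \<Rightarrow> nat \<Rightarrow> (nat \<Rightarrow> 'a \<Rightarrow> real) \<Rightarrow> real" where
  "OPT x\<^sub>0 T f = (INF z\<in>{z. z 0 = x\<^sub>0}. total_cost T f z)"

lemma OPT_eq_total_cost:
  assumes "offline_optimal x\<^sub>0 T f y"
  shows "OPT x\<^sub>0 T f = total_cost T f y"
  unfolding OPT_def
  using assms
  by (intro cInf_eq_minimum) (auto simp: offline_optimal_def is_arg_min_linorder)

text \<open>
  An online algorithm computes its current point from the starting point and the list of requests
  revealed so far, oldest first.
\<close>

type_synonym 'a online_algorithm = "'a \<Rightarrow> ('a \<Rightarrow> real) list \<Rightarrow> 'a"

definition played :: "'a online_algorithm \<Rightarrow> 'a \<Rightarrow> (nat \<Rightarrow> 'a \<Rightarrow> real) \<Rightarrow> nat \<Rightarrow> 'a" where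
  "played A x\<^sub>0 f t = (if t = 0 then x\<^sub>0 else A x\<^sub>0 (map f [1..<Suc t]))"

definition competitive ::
    "(('a::euclidean_space \<Rightarrow> real) \<Rightarrow> bool) \<Rightarrow> real \<Rightarrow> 'a online_algorithm \<Rightarrow> bool" where
  "competitive \<F> c A \<longleftrightarrow>
     (\<forall>x\<^sub>0 T f. (\<forall>t\<in>{1..T}. \<F> (f t)) \<longrightarrow>
        total_cost T f (played A x\<^sub>0 f) \<le> c * OPT x\<^sub>0 T f)"

definition m2m_step :: "'a::euclidean_space \<Rightarrow> ('a \<Rightarrow> real) \<Rightarrow> 'a" where
  "m2m_step p f =
     (let x_star = arg_min f (\<lambda>_. True)
      in THE x. x \<in> closed_segment p x_star \<and> norm (x - p) = f x - f x_star)"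

definition m2m :: "'a::euclidean_space online_algorithm" where
  "m2m x\<^sub>0 fs = foldl m2m_step x\<^sub>0 fs"

lemma played_m2m_0: "played m2m x\<^sub>0 f 0 = x\<^sub>0"
  by (simp add: played_def)

lemma played_m2m_Suc:
  "played m2m x\<^sub>0 f (Suc t) = m2m_step (played m2m x\<^sub>0 f t) (f (Suc t))"
  by (cases t) (simp_all add: played_def m2m_def)

end

theory Submission
  imports Defs
begin

text \<open>
  The potential \<open>2 * sqrt 2 * norm (x - y)\<close> rises by at most \<open>2 * sqrt 2 * norm (y - y')\<close> when
  the offline point moves from \<open>y'\<close> to \<open>y\<close>. Let M2M move from \<open>p\<close> to \<open>x\<close> towards the minimizer
  \<open>z\<close>, so that \<open>r = norm (x - p) = f x\<close>. If \<open>y\<close> is closer to \<open>z\<close> than \<open>norm (x - z) / sqrt 2\<close>,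
  then \<open>y - x\<close> makes an angle of at most 45 degrees with the direction of motion, so the distance
  to \<open>y\<close> drops by at least \<open>r / sqrt 2\<close> and the potential pays for the whole step, which costs
  \<open>2 * r\<close>. Otherwise well-conditioning gives \<open>r \<le> 2 * \<kappa> * f y\<close>, and the offline cost pays for
  \<open>(2 + 2 * sqrt 2) * r\<close>.
\<close>

section \<open>Minimizers and well-conditioned functions\<close>

text \<open>\<open>arg_min\<close> is a Hilbert choice, so it denotes a true minimizer only because
  \<open>min_value\<close> provides one.\<close>

lemma min_value_arg_min:
  assumes "min_value f m"
  shows "f (arg_min f (\<lambda>_. True)) = m" and "m \<le> f x"
proof -
  obtain z where z: "is_arg_min f (\<lambda>_. True) z" "f z = m"
    using assms by (auto simp: min_value_def)
  then have "is_arg_min f (\<lambda>_. True) (arg_min f (\<lambda>_. True))"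
    unfolding arg_min_def by (intro someI)
  with z show "f (arg_min f (\<lambda>_. True)) = m" "m \<le> f x"
    by (auto simp: is_arg_min_linorder intro: antisym)
qed

lemma gradient_eq_0_at_minimum:
  fixes f :: "'a::euclidean_space \<Rightarrow> real"
  assumes "f differentiable (at z)" and "\<And>x. f z \<le> f x"
  shows "gradient f z = 0"
proof -
  have "(f has_derivative (\<lambda>h. h \<bullet> gradient f z)) (at z)"
    using GDERIV_gradient[OF assms(1)] by (simp add: gderiv_def)
  then have "(\<lambda>h. h \<bullet> gradient f z) = (\<lambda>h. 0)"
    using differential_zero_maxmin[of z UNIV] assms(2) by auto
  then show ?thesis
    by (metis inner_eq_zero_iff)
qed

text \<open>Both inequalities, applied to two points at distance 1, give \<alpha> \<le> \<alpha> *
  \<kappa>. The bound settles signs later and lets \<kappa> absorb the offline movement.\<close>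

lemma well_conditioned_ge_1:
  fixes f :: "'a::euclidean_space \<Rightarrow> real"
  assumes "well_conditioned \<kappa> f"
  shows "1 \<le> \<kappa>"
proof -
  obtain \<alpha> where \<alpha>: "\<alpha> > 0" "strongly_convex \<alpha> f" "smooth (\<alpha> * \<kappa>) f"
    using assms by (auto simp: well_conditioned_def)
  obtain b :: 'a where b: "b \<in> Basis"
    using nonempty_Basis by blast
  have "\<alpha> / 2 * (norm (0 - b))\<^sup>2 \<le> \<alpha> * \<kappa> / 2 * (norm (0 - b))\<^sup>2"
    using \<alpha>(2,3) unfolding strongly_convex_def smooth_def by (meson order_trans)
  then show ?thesis
    using b \<alpha>(1) by simp
qed

text \<open>Well-conditioning enters the amortized analysis only through this two-sided bound.\<close>

lemma well_conditioned_quadratic_bounds: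
  fixes f :: "'a::euclidean_space \<Rightarrow> real"
  assumes "well_conditioned \<kappa> f" and "f differentiable (at z)"
    and "f z = 0" and "\<And>x. 0 \<le> f x"
  obtains \<alpha> where "\<alpha> > 0" and "\<And>x. \<alpha> / 2 * (norm (x - z))\<^sup>2 \<le> f x"
    and "\<And>x. f x \<le> \<alpha> * \<kappa> / 2 * (norm (x - z))\<^sup>2"
proof -
  obtain \<alpha> where \<alpha>: "\<alpha> > 0" "strongly_convex \<alpha> f" "smooth (\<alpha> * \<kappa>) f"
    using assms(1) by (auto simp: well_conditioned_def)
  have "gradient f z = 0"
    using assms by (intro gradient_eq_0_at_minimum) auto
  then have "\<alpha> / 2 * (norm (x - z))\<^sup>2 \<le> f x" "f x \<le> \<alpha> * \<kappa> / 2 * (norm (x - z))\<^sup>2" for x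
    using \<alpha>(2,3) assms(3) unfolding strongly_convex_def smooth_def
    by (metis diff_zero inner_zero_left norm_minus_commute)+
  with \<alpha>(1) show thesis
    using that by blast
qed

section \<open>The M2M step is well defined\<close>

text \<open>Along the segment the distance from \<open>p\<close> grows linearly, while by convexity
  the excess of \<open>f\<close> over its minimum cannot grow. The two therefore meet, by the
  intermediate value theorem, and meet only once.\<close>

lemma ex1_m2m_point:
  fixes f :: "'a::euclidean_space \<Rightarrow> real"
  assumes "convex_on UNIV f" and "continuous_on UNIV f" and min: "\<And>x. f z \<le> f x"
  shows "\<exists>!x. x \<in> closed_segment p z \<and> norm (x - p) = f x - f z"
proof -
  define q where "q a = p + a *\<^sub>R (z - p)" for a :: real
  define D where "D = norm (z - p)"
  have seg: "x \<in> closed_segment p z \<longleftrightarrow> (\<exists>a. 0 \<le> a \<and> a \<le> 1 \<and> x = q a)" for x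
    by (auto simp: closed_segment_def q_def algebra_simps)
  have norm_q: "norm (q a - p) = a * D" if "0 \<le> a" for a
    using that by (simp add: q_def D_def)
  have ends: "q 0 = p" "q 1 = z"
    by (auto simp: q_def)
  have "continuous_on {0..1} (\<lambda>a. f (q a) - a * D)"
    unfolding q_def
    by (intro continuous_intros continuous_on_compose2[OF assms(2)]) auto
  \<comment> \<open>The function is \<open>f p\<close>, hence at least \<open>f z\<close>, at 0, and
    \<open>f z - D\<close>, hence at most \<open>f z\<close>, at 1.\<close>
  then obtain a where a: "0 \<le> a" "a \<le> 1" "f (q a) - a * D = f z"
    using IVT2'[of "\<lambda>a. f (q a) - a * D" 1 "f z" 0] min[of p] by (auto simp: ends D_def)
  have uniq: "\<not> (f (q a) - f z = a * D \<and> f (q b) - f z = b * D)"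
    if ab: "0 \<le> a" "a < b" "b \<le> 1" and "D > 0" for a b
  proof -
    \<comment> \<open>\<open>u\<close> is the fraction of the way from \<open>q a\<close> to
      \<open>z\<close> at which \<open>q b\<close> lies; convexity is used between these two
      points.\<close>
    define u where "u = (b - a) / (1 - a)"
    have u: "0 \<le> u" "u \<le> 1" "u * (1 - a) = b - a"
      using ab by (auto simp: u_def divide_simps)
    have "b = a + u * (1 - a)"
      using u(3) by simp
    then have "q b = q (a + u * (1 - a))"
      by (rule arg_cong)
    also have "\<dots> = (1 - u) *\<^sub>R q a + u *\<^sub>R z"
      by (simp add: q_def algebra_simps)
    finally have "q b = (1 - u) *\<^sub>R q a + u *\<^sub>R z" .
    then have "f (q b) \<le> (1 - u) * f (q a) + u * f z"
      using convex_onD[OF assms(1) u(1,2), of "q a" z] by simp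
    also have "\<dots> \<le> (1 - u) * f (q a) + u * f (q a)"
      using min u(1) by (intro add_left_mono mult_left_mono) auto
    also have "\<dots> = f (q a)"
      by (simp add: algebra_simps)
    finally have "f (q b) \<le> f (q a)" .
    moreover have "a * D < b * D"
      using ab \<open>D > 0\<close> by simp
    ultimately show ?thesis
      by linarith
  qed
  show ?thesis
  proof (rule ex1I[of _ "q a"])
    show "q a \<in> closed_segment p z \<and> norm (q a - p) = f (q a) - f z"
      using a seg norm_q by force
  next
    fix x
    assume x: "x \<in> closed_segment p z \<and> norm (x - p) = f x - f z"
    then obtain b where b: "0 \<le> b" "b \<le> 1" "x = q b"
      using seg by blast
    then have fb: "f (q b) - f z = b * D"
      using x norm_q by simp
    show "x = q a"
    proof (cases "D = 0")
      case True
      then show ?thesis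
        by (simp add: b(3) q_def D_def)
    next
      case False
      then have "D > 0"
        by (simp add: D_def)
      then have "\<not> a < b" "\<not> b < a"
        using uniq[of a b] uniq[of b a] a b fb by auto
      then show ?thesis
        using b(3) by simp
    qed
  qed
qed

lemma m2m_step_props:
  fixes f :: "'a::euclidean_space \<Rightarrow> real"
  assumes "request f" and "min_value f 0"
  shows "m2m_step p f \<in> closed_segment p (arg_min f (\<lambda>_. True))"
    and "norm (m2m_step p f - p) = f (m2m_step p f)"
proof -
  let ?z = "arg_min f (\<lambda>_. True)"
  have z: "f ?z = 0" "\<And>x. 0 \<le> f x"
    using min_value_arg_min[OF assms(2)] by auto
  have "continuous_on UNIV f"
    using assms(1) unfolding request_def
    by (intro differentiable_imp_continuous_on differentiable_at_imp_differentiable_on) auto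
  then have "\<exists>!x. x \<in> closed_segment p ?z \<and> norm (x - p) = f x - f ?z"
    using assms(1) z by (intro ex1_m2m_point) (auto simp: request_def)
  from theI'[OF this] show "m2m_step p f \<in> closed_segment p ?z"
    "norm (m2m_step p f - p) = f (m2m_step p f)"
    by (auto simp: m2m_step_def z(1))
qed

section \<open>Geometry of a move towards the minimizer\<close>

lemma norm_decrease_towards:
  fixes p x y z :: "'a::real_inner"
  assumes "x \<in> closed_segment p z" and close: "norm (y - z) < norm (x - z) / sqrt 2"
  shows "norm (x - y) + norm (x - p) / sqrt 2 \<le> norm (p - y)"
proof -
  define s where "s = norm (x - z)"
  define r where "r = norm (x - p)"
  define w where "w = norm (x - y)"
  \<comment> \<open>Strictness of \<open>close\<close> forces \<open>x\<close> and \<open>z\<close>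
    apart, so \<open>s\<close> can be cancelled below.\<close>
  have "0 < s / sqrt 2"
    unfolding s_def by (rule le_less_trans[OF norm_ge_zero close])
  then have nonneg: "s > 0" "r \<ge> 0" "w \<ge> 0"
    by (auto simp: r_def w_def zero_less_divide_iff)
  obtain a where a: "0 \<le> a" "a \<le> 1" "x = (1 - a) *\<^sub>R p + a *\<^sub>R z"
    using assms(1) by (auto simp: closed_segment_def)
  have xp: "x - p = a *\<^sub>R (z - p)" and zx: "z - x = (1 - a) *\<^sub>R (z - p)"
    by (auto simp: a(3) algebra_simps)
  have r: "r = a * norm (z - p)"
    using a(1) by (simp add: r_def xp)
  have s: "s = (1 - a) * norm (z - p)"
    unfolding s_def norm_minus_commute[of x z] using a(2) by (simp add: zx)
  have "(norm (y - z))\<^sup>2 \<le> (s / sqrt 2)\<^sup>2"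
    using close by (intro power_mono) (auto simp: s_def)
  then have "(norm (y - z))\<^sup>2 \<le> s\<^sup>2 / 2"
    by (simp add: power_divide)
  moreover have "(norm (y - z))\<^sup>2 = s\<^sup>2 + w\<^sup>2 - 2 * ((z - x) \<bullet> (y - x))"
    by (simp add: s_def w_def power2_norm_eq_inner inner_diff_left inner_diff_right inner_commute)
  \<comment> \<open>By the law of cosines just stated, twice the inner product is at least
    \<open>s\<^sup>2 / 2 + w\<^sup>2\<close>; the AM-GM inequality turns this into the 45 degree
    bound.\<close>
  moreover have "0 \<le> (s / sqrt 2 - w)\<^sup>2"
    by simp
  then have "2 * (s * w / sqrt 2) \<le> s\<^sup>2 / 2 + w\<^sup>2"
    by (simp add: power2_diff power_divide)
  ultimately have angle: "s * w / sqrt 2 \<le> (z - x) \<bullet> (y - x)"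
    by linarith
  \<comment> \<open>\<open>x - p\<close> and \<open>z - x\<close> are nonnegative multiples of
    \<open>z - p\<close> with lengths \<open>r\<close> and \<open>s\<close>, so the angle bound
    carries over. The product form also covers \<open>r = 0\<close>.\<close>
  have "s * ((x - p) \<bullet> (y - x)) = r * ((z - x) \<bullet> (y - x))"
    by (simp add: xp zx r s)
  also have "\<dots> \<ge> r * (s * w / sqrt 2)"
    using angle nonneg by (intro mult_left_mono) auto
  finally have "s * (r * w / sqrt 2) \<le> s * ((x - p) \<bullet> (y - x))"
    by (simp add: mult_ac)
  then have inner_ge: "r * w / sqrt 2 \<le> (x - p) \<bullet> (y - x)"
    using nonneg(1) mult_le_cancel_left_pos by blast
  have "(w + r / sqrt 2)\<^sup>2 = w\<^sup>2 + r\<^sup>2 / 2 + 2 * (r * w / sqrt 2)"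
    by (simp add: power2_sum power_divide)
  also have "\<dots> \<le> w\<^sup>2 + r\<^sup>2 + 2 * ((x - p) \<bullet> (y - x))"
    using inner_ge by (intro add_mono) auto
  also have "\<dots> = (norm (p - y))\<^sup>2"
    by (simp add: r_def w_def power2_norm_eq_inner inner_diff_left inner_diff_right inner_commute)
  finally show ?thesis
    unfolding r_def w_def by (rule power2_le_imp_le) simp
qed

section \<open>Amortized analysis and competitiveness\<close>

lemma m2m_step_amortized:
  fixes f :: "'a::euclidean_space \<Rightarrow> real"
  assumes wcr: "well_conditioned_request \<kappa> f" and x: "x = m2m_step p f"
  shows "norm (x - p) + f x + 2 * sqrt 2 * (norm (x - y) - norm (p - y'))
           \<le> (4 + 4 * sqrt 2) * \<kappa> * (norm (y - y') + f y)"
proof -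
  define z where "z = arg_min f (\<lambda>_. True)"
  have req: "request f" and wc: "well_conditioned \<kappa> f" and mv: "min_value f 0"
    using wcr by (auto simp: well_conditioned_request_def)
  have fz: "f z = 0" and f_nonneg: "\<And>x. 0 \<le> f x"
    using min_value_arg_min[OF mv] by (auto simp: z_def)
  have seg: "x \<in> closed_segment p z" and r: "norm (x - p) = f x"
    using m2m_step_props[OF req mv] by (auto simp: x z_def)
  have \<kappa>: "1 \<le> \<kappa>"
    using wc by (rule well_conditioned_ge_1)
  \<comment> \<open>The potential change is split at \<open>norm (p - y)\<close>: the offline point
    moves first, and \<open>core\<close> treats the online move with \<open>y\<close> fixed.\<close>
  have core: "2 * f x + 2 * sqrt 2 * (norm (x - y) - norm (p - y)) \<le> (4 + 4 * sqrt 2) * \<kappa> * f y"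
  proof (cases "norm (y - z) < norm (x - z) / sqrt 2")
    case True
    \<comment> \<open>The weight \<open>2 * sqrt 2\<close> is chosen so that this drop is exactly
      \<open>2 * f x\<close>, the cost of the step.\<close>
    have "2 * sqrt 2 * (norm (x - y) - norm (p - y)) \<le> 2 * sqrt 2 * (- (f x / sqrt 2))"
      using norm_decrease_towards[OF seg True] r by (intro mult_left_mono) auto
    then have "2 * f x + 2 * sqrt 2 * (norm (x - y) - norm (p - y)) \<le> 0"
      by simp
    also have "0 \<le> (4 + 4 * sqrt 2) * \<kappa> * f y"
      using \<kappa> f_nonneg by (intro mult_nonneg_nonneg) auto
    finally show ?thesis .
  next
    case False
    have "f differentiable (at z)"
      using req by (simp add: request_def)
    then obtain \<alpha> where \<alpha>: "\<alpha> > 0" "\<And>x. \<alpha> / 2 * (norm (x - z))\<^sup>2 \<le> f x"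
      "\<And>x. f x \<le> \<alpha> * \<kappa> / 2 * (norm (x - z))\<^sup>2"
      using well_conditioned_quadratic_bounds[OF wc _ fz f_nonneg] by blast
    have "(norm (x - z) / sqrt 2)\<^sup>2 \<le> (norm (y - z))\<^sup>2"
      using False by (intro power_mono) auto
    then have "(norm (x - z))\<^sup>2 \<le> 2 * (norm (y - z))\<^sup>2"
      by (simp add: power_divide)
    then have "\<alpha> * \<kappa> / 2 * (norm (x - z))\<^sup>2 \<le> \<alpha> * \<kappa> / 2 * (2 * (norm (y - z))\<^sup>2)"
      using \<alpha>(1) \<kappa> by (intro mult_left_mono) auto
    also have "\<dots> = 2 * \<kappa> * (\<alpha> / 2 * (norm (y - z))\<^sup>2)"
      by simp
    also have "\<dots> \<le> 2 * \<kappa> * f y"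
      using \<alpha>(2)[of y] \<kappa> by (intro mult_left_mono) auto
    finally have fx: "f x \<le> 2 * \<kappa> * f y"
      using \<alpha>(3)[of x] by linarith
    have "norm (x - y) - norm (p - y) \<le> f x"
      using norm_triangle_ineq[of "x - p" "p - y"] r by simp
    then have "2 * sqrt 2 * (norm (x - y) - norm (p - y)) \<le> 2 * sqrt 2 * f x"
      by (intro mult_left_mono) auto
    then have "2 * f x + 2 * sqrt 2 * (norm (x - y) - norm (p - y)) \<le> (2 + 2 * sqrt 2) * f x"
      by (simp add: algebra_simps)
    also have "\<dots> \<le> (2 + 2 * sqrt 2) * (2 * \<kappa> * f y)"
      using fx by (intro mult_left_mono) auto
    also have "\<dots> = (4 + 4 * sqrt 2) * \<kappa> * f y"
      by (simp add: algebra_simps)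
    finally show ?thesis .
  qed
  have "norm (p - y) - norm (p - y') \<le> norm (y - y')"
    using norm_triangle_ineq[of "p - y'" "y' - y"] by (simp add: norm_minus_commute)
  then have "2 * sqrt 2 * (norm (p - y) - norm (p - y')) \<le> 2 * sqrt 2 * norm (y - y')"
    by (intro mult_left_mono) auto
  \<comment> \<open>There is slack here: the constant is dictated by the far case of
    \<open>core\<close>.\<close>
  also have "\<dots> \<le> (4 + 4 * sqrt 2) * 1 * norm (y - y')"
    by (intro mult_right_mono) auto
  also have "\<dots> \<le> (4 + 4 * sqrt 2) * \<kappa> * norm (y - y')"
    using \<kappa> by (intro mult_right_mono mult_left_mono) auto
  finally show ?thesis
    using core r by (simp add: algebra_simps)
qed

lemma m2m_amortized:
  fixes f :: "nat \<Rightarrow> 'a::euclidean_space \<Rightarrow> real" and x\<^sub>0 :: 'a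
  assumes "well_conditioned_request \<kappa> (f t)" and "1 \<le> t"
  defines "x \<equiv> played m2m x\<^sub>0 f"
  shows "step_cost f x t + 2 * sqrt 2 * (norm (x t - y t) - norm (x (t - 1) - y (t - 1)))
           \<le> (4 + 4 * sqrt 2) * \<kappa> * step_cost f y t"
proof -
  have "x t = m2m_step (x (t - 1)) (f t)"
    using played_m2m_Suc[of x\<^sub>0 f "t - 1"] assms(2) by (simp add: x_def)
  from m2m_step_amortized[OF assms(1) this] show ?thesis
    by (simp add: step_cost_def)
qed

text \<open>The potential telescopes, starts at 0 and ends nonnegative. Comparing with every
  sequence from \<open>x\<^sub>0\<close> makes the bound usable for the infimum in
  \<open>OPT\<close>.\<close>

lemma m2m_total_cost_le:
  fixes f :: "nat \<Rightarrow> 'a::euclidean_space \<Rightarrow> real"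
  assumes "\<And>t. t \<in> {1..T} \<Longrightarrow> well_conditioned_request \<kappa> (f t)" and "y 0 = x\<^sub>0"
  shows "total_cost T f (played m2m x\<^sub>0 f) \<le> (4 + 4 * sqrt 2) * \<kappa> * total_cost T f y"
proof -
  let ?x = "played m2m x\<^sub>0 f"
  define \<Phi> where "\<Phi> t = norm (?x t - y t)" for t
  have "(\<Sum>t=1..T. step_cost f ?x t + 2 * sqrt 2 * (\<Phi> t - \<Phi> (t - 1)))
          \<le> (\<Sum>t=1..T. (4 + 4 * sqrt 2) * \<kappa> * step_cost f y t)"
    unfolding \<Phi>_def using assms(1) by (intro sum_mono m2m_amortized) auto
  moreover have "(\<Sum>t=1..T. \<Phi> t - \<Phi> (t - 1)) = \<Phi> T - \<Phi> 0"
    by (induction T) auto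
  ultimately have "total_cost T f ?x + 2 * sqrt 2 * (\<Phi> T - \<Phi> 0)
      \<le> (4 + 4 * sqrt 2) * \<kappa> * total_cost T f y"
    by (simp add: total_cost_def sum.distrib flip: sum_distrib_left)
  moreover have "\<Phi> 0 = 0"
    by (simp add: \<Phi>_def played_m2m_0 assms(2))
  moreover have "0 \<le> 2 * sqrt 2 * \<Phi> T"
    by (simp add: \<Phi>_def)
  ultimately show ?thesis
    by (simp only: diff_zero)
qed

lemma m2m_competitive:
  "competitive (well_conditioned_request \<kappa>) ((4 + 4 * sqrt 2) * \<kappa>)
     (m2m :: ('a::euclidean_space) online_algorithm)"
  unfolding competitive_def
proof (intro allI impI)
  fix x\<^sub>0 :: 'a and T :: nat and f :: "nat \<Rightarrow> 'a \<Rightarrow> real"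
  assume req: "\<forall>t\<in>{1..T}. well_conditioned_request \<kappa> (f t)"
  let ?c = "(4 + 4 * sqrt 2) * \<kappa>"
  show "total_cost T f (played m2m x\<^sub>0 f) \<le> ?c * OPT x\<^sub>0 T f"
  proof (cases "T = 0")
    \<comment> \<open>Without a request \<open>\<kappa>\<close> may be negative, so one cannot divide by \<open>?c\<close>.\<close>
    case True
    have "{z :: nat \<Rightarrow> 'a. z 0 = x\<^sub>0} \<noteq> {}"
      by auto
    then show ?thesis
      by (simp add: True total_cost_def OPT_def)
  next
    case False
    then have "well_conditioned_request \<kappa> (f 1)"
      using req by auto
    then have "1 \<le> \<kappa>"
      using well_conditioned_ge_1 by (auto simp: well_conditioned_request_def)
    then have c: "0 < ?c"
      by (intro mult_pos_pos add_pos_pos) auto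
    \<comment> \<open>After division by the positive factor, the left side is a lower bound of all
      offline costs, hence of their infimum.\<close>
    have "total_cost T f (played m2m x\<^sub>0 f) / ?c \<le> OPT x\<^sub>0 T f"
      unfolding OPT_def
    proof (rule cINF_greatest)
      fix z :: "nat \<Rightarrow> 'a"
      assume "z \<in> {z. z 0 = x\<^sub>0}"
      then have "total_cost T f (played m2m x\<^sub>0 f) \<le> ?c * total_cost T f z"
        using req by (intro m2m_total_cost_le) auto
      then show "total_cost T f (played m2m x\<^sub>0 f) / ?c \<le> total_cost T f z"
        using c by (simp only: pos_divide_le_eq mult.commute)
    qed auto
    then show ?thesis
      using c by (simp only: pos_divide_le_eq mult.commute)
  qed
qed

theorem theorem4:
  fixes \<kappa> :: real
  shows
    "(\<forall>(x\<^sub>0 :: real ^ 'n) T f x y \<Phi>.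
        (\<forall>t\<in>{1..T}. well_conditioned_request \<kappa> (f t)) \<longrightarrow>
        x = played m2m x\<^sub>0 f \<longrightarrow>
        offline_optimal x\<^sub>0 T f y \<longrightarrow>
        \<Phi> = (\<lambda>t. norm (x t - y t)) \<longrightarrow>
        (\<forall>t\<in>{1..T}.
           norm (x t - x (t - 1)) + f t (x t) + 2 * sqrt 2 * (\<Phi> t - \<Phi> (t - 1))
             \<le> (4 + 4 * sqrt 2) * \<kappa> * (norm (y t - y (t - 1)) + f t (y t)))) \<and>
     competitive (well_conditioned_request \<kappa>) ((4 + 4 * sqrt 2) * \<kappa>)
       (m2m :: (real ^ 'n) online_algorithm)"
  by (auto intro: m2m_amortized[unfolded step_cost_def, simplified] m2m_competitive)

end
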